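(* Let $M,K\in\mathbb{R}^{n\times n}$ be symmetric positive definite, $L=M^{-1}K$, and $\mathbf b\in\mathbb{R}^n$. Let $f$ be analytic in a neighbourhood of the numerical range $\mathbb{W}(L)$ and let $(t_j)_{j=0}^k\subset[0,\infty)\cup\{\infty\}$ be pairwise distinct. Then the reduced basis approximation $$\mathbf u^{\mathrm{RB}}_{k+1}=V f(V^TLV)V^T\mathbf b$$ with snapshots $(t_j)_{j=0}^k$ coincides with the rational Krylov approximation $$\mathbf u_{k+1}=W f(W^TLW)W^T\mathbf b$$ with poles $(-t_j)_{j=0}^k$. Here $V\in\mathbb{R}^{n\times(k+1)}$ is any matrix whose columns form an orthonormal basis of the reduced space $\mathcal V_{k+1}(L,\mathbf b)$ with snapshots $(t_j)_{j=0}^k$, and $W\in\mathbb{R}^{n\times(k+1)}$ is any matrix whose columns form an orthonormal basis of the rational Krylov space $\mathcal Q_{k+1}(L,\mathbf b)$ with poles $(-t_j)_{j=0}^k$.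
   Context: $M$ and $K$ are the mass and stiffness matrices of a discretized self-adjoint elliptic diffusion operator; $L=M^{-1}K$ has only positive real eigenvalues. The numerical range is $\mathbb{W}(L)=\{x^*Lx : x\in\mathbb{C}^n,\ \|x\|=1\}$ with the Euclidean norm; orthonormality is with respect to the Euclidean inner product; $f$ of a matrix is the usual (holomorphic) matrix function. Reduced space: for $t\in[0,\infty)$ put $\mathbf w(t)=(tI+L)^{-1}\mathbf b$ and $\mathbf w(\infty):=\mathbf b$. Then $\mathcal V_{k+1}(L,\mathbf b)=\operatorname{span}\{\mathbf w(t_0),\dots,\mathbf w(t_k)\}$; the parameters $t_j$ are called snapshots. Rational Krylov space: for poles $(d_j)_{j=0}^k\subset(-\infty,0]\cup\{-\infty\}$ put $q_k(z)=\prod_{0\le j\le k,\ d_j\ne-\infty}(z-d_j)$. Then $\mathcal Q_{k+1}(L,\mathbf b)=q_k(L)^{-1}\operatorname{span}\{\mathbf b,L\mathbf b,\dots,L^k\mathbf b\}$. The pole $-t_j$ for $t_j=\infty$ is $-\infty$. The reduced space and the rational Krylov space are taken to have dimension $k+1$, so that bases with $k+1$ elements exist. *)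

theory Defs
  imports
    "HOL-Complex_Analysis.Complex_Residues"
    "Jordan_Normal_Form.Char_Poly"
    "Jordan_Normal_Form.VS_Connect"
    "Jordan_Normal_Form.Gauss_Jordan_Elimination"
    "Jordan_Normal_Form.Conjugate"
begin

no_notation Finite_Cartesian_Product.vec_nth (infixl "$" 90)
no_notation Inner_Product.real_inner_class.inner (infix "\<bullet>" 70)

hide_type (open) Finite_Cartesian_Product.vec

abbreviation cmat :: "real mat \<Rightarrow> complex mat" where
  "cmat \<equiv> map_mat complex_of_real"

abbreviation cvec :: "real Matrix.vec \<Rightarrow> complex Matrix.vec" where
  "cvec \<equiv> map_vec complex_of_real"

definition spd_mat :: "nat \<Rightarrow> real mat \<Rightarrow> bool" where
  "spd_mat n A \<longleftrightarrow> A \<in> carrier_mat n n \<and> transpose_mat A = A \<and>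
     (\<forall>x \<in> carrier_vec n. x \<noteq> 0\<^sub>v n \<longrightarrow> x \<bullet> (A *\<^sub>v x) > 0)"

text \<open>Only meaningful for invertible square matrices; unspecified otherwise.\<close>

definition mat_inv :: "'a::field mat \<Rightarrow> 'a mat" where
  "mat_inv A = the (mat_inverse A)"

abbreviation vec_span :: "nat \<Rightarrow> real Matrix.vec set \<Rightarrow> real Matrix.vec set" where
  "vec_span n \<equiv> LinearCombinations.module.span class_ring (module_vec TYPE(real) n)"

text \<open>Since \<open>x \<bullet>c y\<close> conjugates its second argument, \<open>(A *\<^sub>v x) \<bullet>c x\<close> is $x^* A x$.\<close>

definition numerical_range :: "complex mat \<Rightarrow> complex set" where
  "numerical_range A = {(A *\<^sub>v x) \<bullet>c x | x.
     x \<in> carrier_vec (dim_row A) \<and> sqrt (\<Sum>i<dim_row A. (cmod (x $ i))\<^sup>2) = 1}"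

text \<open>
  The holomorphic functional calculus
  $f(A) = \frac{1}{2\pi i}\oint_\Gamma f(z)\,(zI - A)^{-1}\,dz$, taken entrywise, where \<open>\<Gamma>\<close> is the
  union of small positively oriented circles around the distinct eigenvalues of \<open>A\<close>. The constant
  \<^const>\<open>residue\<close> is by definition the integral over a sufficiently small circle divided by
  $2\pi i$. The result is meaningful when \<open>f\<close> is analytic at every eigenvalue of \<open>A\<close>.
\<close>

definition mat_fun :: "(complex \<Rightarrow> complex) \<Rightarrow> complex mat \<Rightarrow> complex mat" where
  "mat_fun f A = mat (dim_row A) (dim_row A) (\<lambda>(i, j).
     \<Sum>\<mu> | eigenvalue A \<mu>.
       residue (\<lambda>z. f z * mat_inv (z \<cdot>\<^sub>m 1\<^sub>m (dim_row A) - A) $$ (i, j)) \<mu>)"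

definition poly_mat :: "'a::comm_ring_1 poly \<Rightarrow> 'a mat \<Rightarrow> 'a mat" where
  "poly_mat p A = mat (dim_row A) (dim_row A) (\<lambda>(i, j).
     \<Sum>l\<le>degree p. coeff p l * (A ^\<^sub>m l) $$ (i, j))"

definition snapshot_vec :: "real mat \<Rightarrow> real Matrix.vec \<Rightarrow> ereal \<Rightarrow> real Matrix.vec" where
  "snapshot_vec L b t =
     (if t = \<infinity> then b
      else mat_inv (real_of_ereal t \<cdot>\<^sub>m 1\<^sub>m (dim_row L) + L) *\<^sub>v b)"

text \<open>
  In the two definitions below the parameters are indexed by \<open>0, \<dots>, k\<close>, so the
  expected dimension is \<open>k + 1\<close>.
\<close>

definition reduced_space ::
    "real mat \<Rightarrow> real Matrix.vec \<Rightarrow> nat \<Rightarrow> (nat \<Rightarrow> ereal) \<Rightarrow> real Matrix.vec set" where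
  "reduced_space L b k t = vec_span (dim_row L) ((\<lambda>j. snapshot_vec L b (t j)) ` {..k})"

definition pole_poly :: "nat \<Rightarrow> (nat \<Rightarrow> ereal) \<Rightarrow> real poly" where
  "pole_poly k d = (\<Prod>j | j \<le> k \<and> d j \<noteq> -\<infinity>. [:- real_of_ereal (d j), 1:])"

definition rational_krylov_space ::
    "real mat \<Rightarrow> real Matrix.vec \<Rightarrow> nat \<Rightarrow> (nat \<Rightarrow> ereal) \<Rightarrow> real Matrix.vec set" where
  "rational_krylov_space L b k d =
     (\<lambda>v. mat_inv (poly_mat (pole_poly k d) L) *\<^sub>v v) `
       vec_span (dim_row L) ((\<lambda>j. (L ^\<^sub>m j) *\<^sub>v b) ` {..k})"

text \<open>
  The columns of the \<open>n \<times> m\<close> matrix \<open>V\<close> form an orthonormal basis of \<open>S\<close>. Linear independence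
  follows from orthonormality; in particular \<open>S\<close> then has dimension \<open>m\<close>.
\<close>

definition orthonormal_basis_mat ::
    "nat \<Rightarrow> nat \<Rightarrow> real mat \<Rightarrow> real Matrix.vec set \<Rightarrow> bool" where
  "orthonormal_basis_mat n m V S \<longleftrightarrow> V \<in> carrier_mat n m \<and>
     (\<forall>i<m. \<forall>j<m. col V i \<bullet> col V j = (if i = j then 1 else 0)) \<and>
     vec_span n (set (cols V)) = S"

text \<open>
  $V f(V^T L V) V^T b$. The result is complex because \<open>f\<close> need not be real on the real axis.
\<close>

definition projected_approx ::
    "(complex \<Rightarrow> complex) \<Rightarrow> real mat \<Rightarrow> real Matrix.vec \<Rightarrow> real mat \<Rightarrow> complex Matrix.vec" where
  "projected_approx f L b V =
     cmat V *\<^sub>v (mat_fun f (cmat (transpose_mat V * L * V)) *\<^sub>v cvec (transpose_mat V *\<^sub>v b))"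

end

theory Submission
  imports Defs
begin

text \<open>
  Multiplying a snapshot $(t_j I + L)^{-1} b$ by the denominator $q(L)$ cancels the factor
  $t_j I + L$ and leaves a polynomial of degree at most $k$ in $L$ applied to $b$; a snapshot at
  infinity costs no factor of $q$, so $q(L) b$ has degree at most $k$ as well. Hence the reduced
  space lies in the rational Krylov space, and $V = W U$ with $U = W^T V$. Orthonormality makes the
  square matrix $U$ orthogonal, so the two compressions of $L$ are similar via $U$. The functional
  calculus is compatible with similarity because $f$ is analytic at the eigenvalues of $W^T L W$,
  which all lie in the numerical range of $L$.
\<close>

section \<open>Inverses and scalar multiples of matrices\<close>

lemma mat_inv:
  fixes A :: "'a::field mat"
  assumes A: "A \<in> carrier_mat n n" and d: "det A \<noteq> 0"
  shows "mat_inv A \<in> carrier_mat n n" "A * mat_inv A = 1\<^sub>m n" "mat_inv A * A = 1\<^sub>m n"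
proof -
  have "mat_inverse A \<noteq> None"
    using mat_inverse(1)[OF A, of undefined] det_non_zero_imp_unit[OF A d, of undefined] by auto
  then obtain B where B: "mat_inverse A = Some B" by blast
  show "mat_inv A \<in> carrier_mat n n" "A * mat_inv A = 1\<^sub>m n" "mat_inv A * A = 1\<^sub>m n"
    using mat_inverse(2)[OF A B] by (auto simp: mat_inv_def B)
qed

text \<open>A right inverse suffices: taking determinants in \<open>A * B\<close> shows that
  \<open>A\<close> is invertible, and then \<open>A\<close> can be cancelled on the left. Later
  inverses are identified by exhibiting such a \<open>B\<close>.\<close>

lemma mat_inv_unique:
  fixes A :: "'a::field mat"
  assumes A: "A \<in> carrier_mat n n" and B: "B \<in> carrier_mat n n" and AB: "A * B = 1\<^sub>m n"
  shows "mat_inv A = B"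
proof -
  have "det A * det B = 1" using det_mult[OF A B] AB by simp
  then have d: "det A \<noteq> 0" by auto
  note i = mat_inv[OF A d]
  have "mat_inv A = mat_inv A * (A * B)" using i(1) AB by simp
  also have "\<dots> = (mat_inv A * A) * B" using i(1) A B by (simp add: assoc_mult_mat)
  also have "\<dots> = B" using i(3) B by simp
  finally show ?thesis .
qed

lemma smult_one_mat [simp]: "(1 :: 'a::monoid_mult) \<cdot>\<^sub>m A = A"
  by (rule eq_matI) auto

lemma smult_mat_mult_vec:
  "x \<in> carrier_vec (dim_col A) \<Longrightarrow> ((c :: 'a::comm_semiring_0) \<cdot>\<^sub>m A) *\<^sub>v x = c \<cdot>\<^sub>v (A *\<^sub>v x)"
  by (rule eq_vecI) (auto simp: scalar_prod_def sum_distrib_left mult.assoc)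

lemma transpose_smult: "transpose_mat (c \<cdot>\<^sub>m A) = c \<cdot>\<^sub>m transpose_mat A"
  by (rule eq_matI) auto

lemma smult_zero_mat: "A \<in> carrier_mat n m \<Longrightarrow> (0 :: 'a::mult_zero) \<cdot>\<^sub>m A = 0\<^sub>m n m"
  by (rule eq_matI) auto

section \<open>Polynomials in a matrix and the Krylov space\<close>

lemma poly_mat_carrier: "A \<in> carrier_mat n n \<Longrightarrow> poly_mat p A \<in> carrier_mat n n"
  unfolding poly_mat_def by auto

lemma dim_poly_mat [simp]: "dim_row (poly_mat p A) = dim_row A" "dim_col (poly_mat p A) = dim_row A"
  by (simp_all add: poly_mat_def)

text \<open>Coefficients beyond the degree vanish. This gives polynomials of different degrees a
  common summation range.\<close>

lemma poly_mat_index: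
  assumes A: "A \<in> carrier_mat n n" and N: "degree p \<le> N" and ij: "i < n" "j < n"
  shows "poly_mat p A $$ (i, j) = (\<Sum>l\<le>N. coeff p l * (A ^\<^sub>m l) $$ (i, j))"
proof -
  have "(\<Sum>l\<le>degree p. coeff p l * (A ^\<^sub>m l) $$ (i, j)) = (\<Sum>l\<le>N. coeff p l * (A ^\<^sub>m l) $$ (i, j))"
    using N by (intro sum.mono_neutral_left) (auto simp: coeff_eq_0)
  then show ?thesis using A ij by (simp add: poly_mat_def)
qed

lemma poly_mat_0: "A \<in> carrier_mat n n \<Longrightarrow> poly_mat 0 A = 0\<^sub>m n n"
  by (rule eq_matI) (auto simp: poly_mat_def)

lemma poly_mat_add:
  assumes A: "A \<in> carrier_mat n n"
  shows "poly_mat (p + q) A = poly_mat p A + poly_mat q A"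
proof (rule eq_matI)
  fix i j assume "i < dim_row (poly_mat p A + poly_mat q A)" "j < dim_col (poly_mat p A + poly_mat q A)"
  then have ij: "i < n" "j < n" using A by (auto simp: poly_mat_def)
  let ?N = "max (degree p) (degree q)"
  show "poly_mat (p + q) A $$ (i, j) = (poly_mat p A + poly_mat q A) $$ (i, j)"
    using ij A poly_mat_index[OF A _ ij, of p ?N] poly_mat_index[OF A _ ij, of q ?N]
      poly_mat_index[OF A _ ij, of "p + q" ?N]
    by (simp add: degree_add_le_max sum.distrib distrib_right poly_mat_def)
qed (auto simp: poly_mat_def)

lemma poly_mat_smult:
  assumes A: "A \<in> carrier_mat n n"
  shows "poly_mat (Polynomial.smult c p) A = c \<cdot>\<^sub>m poly_mat p A"
proof (rule eq_matI)
  fix i j assume "i < dim_row (c \<cdot>\<^sub>m poly_mat p A)" "j < dim_col (c \<cdot>\<^sub>m poly_mat p A)"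
  then have ij: "i < n" "j < n" using A by (auto simp: poly_mat_def)
  have "(c \<cdot>\<^sub>m poly_mat p A) $$ (i, j) = c * poly_mat p A $$ (i, j)"
    using ij A by (simp add: poly_mat_def)
  also have "\<dots> = poly_mat (Polynomial.smult c p) A $$ (i, j)"
    using poly_mat_index[OF A order_refl ij, of p] poly_mat_index[OF A degree_smult_le ij, of c p]
    by (simp add: sum_distrib_left mult.assoc)
  finally show "poly_mat (Polynomial.smult c p) A $$ (i, j) = (c \<cdot>\<^sub>m poly_mat p A) $$ (i, j)" ..
qed (auto simp: poly_mat_def)

text \<open>This is the Horner recursion, which opens \<open>poly_mat\<close> to induction over
  \<open>pCons\<close>.\<close>

lemma poly_mat_pCons:
  assumes A: "A \<in> carrier_mat n n"
  shows "poly_mat (pCons a p) A = a \<cdot>\<^sub>m 1\<^sub>m n + poly_mat p A * A"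
proof (rule eq_matI)
  fix i j assume "i < dim_row (a \<cdot>\<^sub>m 1\<^sub>m n + poly_mat p A * A)" "j < dim_col (a \<cdot>\<^sub>m 1\<^sub>m n + poly_mat p A * A)"
  then have ij: "i < n" "j < n" using A by (auto simp: poly_mat_def)
  have pw: "(A ^\<^sub>m Suc l) $$ (i, j) = (\<Sum>m<n. (A ^\<^sub>m l) $$ (i, m) * A $$ (m, j))" for l
    using ij A pow_carrier_mat[OF A, of l]
    by (simp add: scalar_prod_def lessThan_atLeast0)
  have "(poly_mat p A * A) $$ (i, j) = (\<Sum>m<n. poly_mat p A $$ (i, m) * A $$ (m, j))"
    using ij A poly_mat_carrier[OF A, of p] by (simp add: scalar_prod_def lessThan_atLeast0)
  also have "\<dots> = (\<Sum>m<n. \<Sum>l\<le>degree p. coeff p l * ((A ^\<^sub>m l) $$ (i, m) * A $$ (m, j)))"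
    using ij by (intro sum.cong refl) (simp add: poly_mat_index[OF A order_refl] sum_distrib_right mult.assoc)
  also have "\<dots> = (\<Sum>l\<le>degree p. coeff p l * (A ^\<^sub>m Suc l) $$ (i, j))"
    by (subst sum.swap) (simp only: pw sum_distrib_left)
  finally have *: "(poly_mat p A * A) $$ (i, j) = \<dots>" .
  have "poly_mat (pCons a p) A $$ (i, j) = a * (A ^\<^sub>m 0) $$ (i, j) + (poly_mat p A * A) $$ (i, j)"
    unfolding * poly_mat_index[OF A degree_pCons_le ij] sum.atMost_Suc_shift by simp
  also have "\<dots> = (a \<cdot>\<^sub>m 1\<^sub>m n + poly_mat p A * A) $$ (i, j)"
    using ij A poly_mat_carrier[OF A, of p] by simp
  finally show "poly_mat (pCons a p) A $$ (i, j) = (a \<cdot>\<^sub>m 1\<^sub>m n + poly_mat p A * A) $$ (i, j)" .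
qed (use A in \<open>auto simp: poly_mat_def\<close>)

text \<open>The Horner recursion puts the factor \<open>A\<close> on the right. In a product of two
  polynomials it then has to be moved past the second one.\<close>

lemma poly_mat_commute:
  assumes A: "A \<in> carrier_mat n n"
  shows "A * poly_mat p A = poly_mat p A * A"
proof (induction p)
  case 0
  show ?case using A by (simp add: poly_mat_0)
next
  case (pCons a p)
  have P: "poly_mat p A \<in> carrier_mat n n" using A by (rule poly_mat_carrier)
  then have "A * poly_mat (pCons a p) A = a \<cdot>\<^sub>m A + A * (poly_mat p A * A)"
    using A by (simp add: poly_mat_pCons[OF A] mult_add_distrib_mat[of _ n n _ n] mult_smult_distrib[of _ n n _ n])
  also have "A * (poly_mat p A * A) = poly_mat p A * A * A"
    using A P pCons.IH by (metis assoc_mult_mat)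
  also have "a \<cdot>\<^sub>m A + poly_mat p A * A * A = poly_mat (pCons a p) A * A"
    using A P by (simp add: poly_mat_pCons[OF A] add_mult_distrib_mat[of _ n n] mult_smult_assoc_mat[of _ n n])
  finally show ?case .
qed

lemma poly_mat_mult:
  assumes A: "A \<in> carrier_mat n n"
  shows "poly_mat (p * q) A = poly_mat p A * poly_mat q A"
proof (induction p)
  case 0
  show ?case using A by (simp add: poly_mat_0 left_mult_zero_mat[of _ n n])
next
  case (pCons a p)
  have P: "poly_mat p A \<in> carrier_mat n n" and Q: "poly_mat q A \<in> carrier_mat n n" using A by (simp_all add: poly_mat_carrier)
  have "poly_mat (pCons a p * q) A = a \<cdot>\<^sub>m poly_mat q A + poly_mat p A * poly_mat q A * A"
    using A P Q by (simp add: poly_mat_add poly_mat_smult poly_mat_pCons smult_zero_mat[of _ n n] pCons.IH)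
  also have "poly_mat p A * poly_mat q A * A = poly_mat p A * A * poly_mat q A"
    using A P Q by (simp add: assoc_mult_mat[of _ n n _ n _ n] poly_mat_commute)
  finally show ?case
    using A P Q by (simp add: poly_mat_pCons[OF A] add_mult_distrib_mat[of _ n n] mult_smult_assoc_mat[of _ n n])
qed

lemma poly_mat_linear:
  assumes A: "A \<in> carrier_mat n n"
  shows "poly_mat [:c, 1:] A = c \<cdot>\<^sub>m 1\<^sub>m n + A"
  using A by (intro eq_matI) (auto simp: poly_mat_pCons[OF A] poly_mat_0)

lemma poly_mat_1: "A \<in> carrier_mat n n \<Longrightarrow> poly_mat 1 A = 1\<^sub>m n"
  by (simp add: one_pCons poly_mat_pCons poly_mat_0 left_mult_zero_mat[of _ n n])

text \<open>With linear factors this reduces the invertibility of the denominator q(L) to that of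
  the single shifts of L.\<close>

lemma det_poly_mat_prod_nonzero:
  fixes A :: "'a::field mat"
  assumes A: "A \<in> carrier_mat n n" and "finite J" and "\<And>j. j \<in> J \<Longrightarrow> det (poly_mat (p j) A) \<noteq> 0"
  shows "det (poly_mat (\<Prod>j\<in>J. p j) A) \<noteq> 0"
  using assms(2,3)
  by (induction J) (simp_all add: poly_mat_1[OF A] poly_mat_mult[OF A] det_mult[OF poly_mat_carrier[OF A] poly_mat_carrier[OF A]])

lemma poly_mat_vec_in_krylov:
  assumes A: "A \<in> carrier_mat n n" and b: "b \<in> carrier_vec n" and p: "degree p \<le> k"
  shows "poly_mat p A *\<^sub>v b \<in> vec_span n ((\<lambda>j. (A ^\<^sub>m j) *\<^sub>v b) ` {..k})"
proof -
  interpret vec_space "TYPE(real)" n .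
  have vec_add_smult: "vec n (\<lambda>i. F i + d * u $ i) = vec n F + d \<cdot>\<^sub>v u"
    if "u \<in> carrier_vec n" for F d and u :: "real vec"
    using that by (intro eq_vecI) auto
  let ?S = "(\<lambda>j. (A ^\<^sub>m j) *\<^sub>v b) ` {..k}"
  have S: "?S \<subseteq> carrier_vec n" using b by (auto intro!: mult_mat_vec_carrier[of _ n n] pow_carrier_mat[OF A])
  \<comment> \<open>Only the length \<open>N\<close> of the sum varies in the induction; the
    generators stay those up to \<open>k\<close>, so every partial sum lies in the same
    span.\<close>
  have "vec n (\<lambda>i. \<Sum>l\<le>N. c l * ((A ^\<^sub>m l) *\<^sub>v b) $ i) \<in> span ?S" if "N \<le> k" for N and c :: "nat \<Rightarrow> real"
    using that
  proof (induction N)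
    case 0
    have "vec n (\<lambda>i. \<Sum>l\<le>0. c l * ((A ^\<^sub>m l) *\<^sub>v b) $ i) = c 0 \<cdot>\<^sub>v ((A ^\<^sub>m 0) *\<^sub>v b)"
      using A b by (intro eq_vecI) auto
    moreover have "c 0 \<cdot>\<^sub>v ((A ^\<^sub>m 0) *\<^sub>v b) \<in> span ?S"
      by (intro smult_in_span S span_mem imageI) auto
    ultimately show ?case by simp
  next
    case (Suc N)
    let ?u = "(A ^\<^sub>m Suc N) *\<^sub>v b"
    have "?u \<in> carrier_vec n" using pow_carrier_mat[OF A, of "Suc N"] b by (rule mult_mat_vec_carrier)
    then have "vec n (\<lambda>i. \<Sum>l\<le>Suc N. c l * ((A ^\<^sub>m l) *\<^sub>v b) $ i)
      = vec n (\<lambda>i. \<Sum>l\<le>N. c l * ((A ^\<^sub>m l) *\<^sub>v b) $ i) + c (Suc N) \<cdot>\<^sub>v ?u"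
      by (simp only: sum.atMost_Suc vec_add_smult)
    moreover have "c (Suc N) \<cdot>\<^sub>v ?u \<in> span ?S"
      using Suc.prems by (intro smult_in_span S span_mem imageI) auto
    ultimately show ?case using Suc span_add1[OF S] by auto
  qed
  \<comment> \<open>Padding with zero coefficients up to \<open>k\<close> brings the vector into the
    form just treated, with \<open>N = k\<close>.\<close>
  moreover have "poly_mat p A *\<^sub>v b = vec n (\<lambda>i. \<Sum>l\<le>k. coeff p l * ((A ^\<^sub>m l) *\<^sub>v b) $ i)"
  proof (rule eq_vecI)
    fix i assume "i < dim_vec (vec n (\<lambda>i. \<Sum>l\<le>k. coeff p l * ((A ^\<^sub>m l) *\<^sub>v b) $ i))"
    then have i: "i < n" by simp
    have pw: "((A ^\<^sub>m l) *\<^sub>v b) $ i = (\<Sum>m<n. (A ^\<^sub>m l) $$ (i, m) * b $ m)" for l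
      using i b A pow_carrier_mat[OF A, of l] by (simp add: scalar_prod_def lessThan_atLeast0)
    have "(poly_mat p A *\<^sub>v b) $ i = (\<Sum>m<n. poly_mat p A $$ (i, m) * b $ m)"
      using i b A poly_mat_carrier[OF A, of p] by (simp add: scalar_prod_def lessThan_atLeast0)
    also have "\<dots> = (\<Sum>m<n. \<Sum>l\<le>k. coeff p l * ((A ^\<^sub>m l) $$ (i, m) * b $ m))"
      using i by (intro sum.cong refl) (simp add: poly_mat_index[OF A p] sum_distrib_right mult.assoc)
    also have "\<dots> = (\<Sum>l\<le>k. coeff p l * ((A ^\<^sub>m l) *\<^sub>v b) $ i)"
      by (subst sum.swap) (simp only: pw sum_distrib_left)
    finally show "(poly_mat p A *\<^sub>v b) $ i = vec n (\<lambda>i. \<Sum>l\<le>k. coeff p l * ((A ^\<^sub>m l) *\<^sub>v b) $ i) $ i"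
      using i by simp
  qed (use poly_mat_carrier[OF A, of p] in auto)
  ultimately show ?thesis by simp
qed

section \<open>Invertibility of the shifted operator\<close>

lemma spd_det_nonzero:
  assumes "spd_mat n A" shows "det A \<noteq> 0"
proof
  have A: "A \<in> carrier_mat n n" using assms by (simp add: spd_mat_def)
  assume "det A = 0"
  then obtain v where "v \<in> carrier_vec n" "v \<noteq> 0\<^sub>v n" "A *\<^sub>v v = 0\<^sub>v n"
    using det_0_iff_vec_prod_zero[OF A] by auto
  then show False using assms unfolding spd_mat_def by fastforce
qed

text \<open>Strict positivity already comes from the summand \<open>K\<close>, so the value
  \<open>s = 0\<close> is allowed.\<close>

lemma spd_mat_add_smult:
  assumes M: "spd_mat n M" and K: "spd_mat n K" and s: "0 \<le> s"
  shows "spd_mat n (s \<cdot>\<^sub>m M + K)"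
proof -
  have MC: "M \<in> carrier_mat n n" and KC: "K \<in> carrier_mat n n"
    using M K by (simp_all add: spd_mat_def)
  have "0 < x \<bullet> ((s \<cdot>\<^sub>m M + K) *\<^sub>v x)" if x: "x \<in> carrier_vec n" "x \<noteq> 0\<^sub>v n" for x
  proof -
    have "x \<bullet> ((s \<cdot>\<^sub>m M + K) *\<^sub>v x) = s * (x \<bullet> (M *\<^sub>v x)) + x \<bullet> (K *\<^sub>v x)"
      using MC KC x by (simp add: add_mult_distrib_mat_vec[of _ n n] smult_mat_mult_vec scalar_prod_add_distrib[of _ n])
    moreover have "0 < x \<bullet> (M *\<^sub>v x)" "0 < x \<bullet> (K *\<^sub>v x)" using M K x by (auto simp: spd_mat_def)
    ultimately show ?thesis using s by (simp add: add_nonneg_pos)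
  qed
  moreover have "transpose_mat (s \<cdot>\<^sub>m M + K) = s \<cdot>\<^sub>m M + K"
    using M K MC KC by (simp add: spd_mat_def transpose_add[of _ n n] transpose_smult)
  ultimately show ?thesis using MC KC by (simp add: spd_mat_def)
qed

text \<open>L itself need not be symmetric, but M (sI + L) = sM + K is symmetric positive definite,
  hence has nonzero determinant.\<close>

lemma det_shifted_nonzero:
  assumes M: "spd_mat n M" and K: "spd_mat n K" and s: "0 \<le> s"
  shows "det (s \<cdot>\<^sub>m 1\<^sub>m n + mat_inv M * K) \<noteq> 0"
proof -
  have MC: "M \<in> carrier_mat n n" and KC: "K \<in> carrier_mat n n"
    using M K by (simp_all add: spd_mat_def)
  note i = mat_inv[OF MC spd_det_nonzero[OF M]]
  have "M * (s \<cdot>\<^sub>m 1\<^sub>m n + mat_inv M * K) = s \<cdot>\<^sub>m M + M * (mat_inv M * K)"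
    using MC KC i(1) by (simp add: mult_add_distrib_mat[of _ n n _ n] mult_smult_distrib[of _ n n _ n])
  also have "M * (mat_inv M * K) = K"
    using MC KC i by (simp flip: assoc_mult_mat[of _ n n _ n _ n])
  finally have "det M * det (s \<cdot>\<^sub>m 1\<^sub>m n + mat_inv M * K) = det (s \<cdot>\<^sub>m M + K)"
    using MC KC i(1) by (metis det_mult add_carrier_mat mult_carrier_mat one_carrier_mat smult_carrier_mat)
  then show ?thesis using spd_det_nonzero[OF spd_mat_add_smult[OF M K s]] by auto
qed

section \<open>Snapshots as rational functions of the operator\<close>

text \<open>The poles are the negated snapshot parameters, so the denominator has the factors z +
  t_j, which are the shifts inverted in the snapshots. An infinite parameter contributes no
  factor.\<close>

lemma snapshot_in_rational_krylov_space:
  assumes L: "L \<in> carrier_mat n n" and b: "b \<in> carrier_vec n"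
    and inv: "\<And>s. 0 \<le> s \<Longrightarrow> det (s \<cdot>\<^sub>m 1\<^sub>m n + L) \<noteq> 0"
    and t: "\<And>j. j \<le> k \<Longrightarrow> 0 \<le> t j" and j: "j \<le> k"
  shows "snapshot_vec L b (t j) \<in> rational_krylov_space L b k (\<lambda>j. - t j)"
proof -
  let ?J = "{j. j \<le> k \<and> t j \<noteq> \<infinity>}"
  define g where "g = (\<lambda>j. [:real_of_ereal (t j), 1:])"
  have q: "pole_poly k (\<lambda>j. - t j) = (\<Prod>j\<in>?J. g j)"
    unfolding pole_poly_def g_def by (intro prod.cong) auto
  define Q where "Q = poly_mat (\<Prod>j\<in>?J. g j) L"
  have QC: "Q \<in> carrier_mat n n" using L by (simp add: Q_def poly_mat_carrier)
  \<comment> \<open>An infinite \<open>t j\<close> is covered too: \<open>real_of_ereal\<close>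
    sends it to 0, and the shift by 0 is admissible in \<open>inv\<close>.\<close>
  have gL: "det (poly_mat (g j) L) \<noteq> 0" if "j \<le> k" for j
    unfolding g_def poly_mat_linear[OF L] using t[OF that] by (intro inv) (simp add: real_of_ereal_pos)
  have dQ: "det Q \<noteq> 0" unfolding Q_def
    by (rule det_poly_mat_prod_nonzero[OF L]) (auto dest: gL)
  note Qi = mat_inv[OF QC dQ]
  let ?s = "snapshot_vec L b (t j)"
  have deg: "degree (\<Prod>j\<in>I. g j) \<le> card I" if "finite I" for I
    using degree_prod_sum_le[OF that, of g] by (simp add: g_def)
  \<comment> \<open>Membership is tested after multiplication by the invertible \<open>Q\<close>:
    what remains is to find a numerator of degree at most \<open>k\<close>.\<close>
  have "\<exists>p. degree p \<le> k \<and> ?s \<in> carrier_vec n \<and> Q *\<^sub>v ?s = poly_mat p L *\<^sub>v b"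
  proof (cases "t j = \<infinity>")
    case True
    \<comment> \<open>The index \<open>j\<close> drops out of \<open>?J\<close>, which leaves at
      most \<open>k\<close> of the k + 1 indices. The numerator is then the whole
      denominator.\<close>
    then have "?J \<subseteq> {..k} - {j}" by auto
    then have "card ?J \<le> card ({..k} - {j})" by (intro card_mono) auto
    then have "card ?J \<le> k" using j by simp
    moreover have "degree (\<Prod>j\<in>?J. g j) \<le> card ?J" by (rule deg) simp
    ultimately have "degree (\<Prod>j\<in>?J. g j) \<le> k" by simp
    moreover have "?s = b" using True by (simp add: snapshot_vec_def)
    ultimately show ?thesis using b unfolding Q_def by (intro exI[of _ "\<Prod>j\<in>?J. g j"]) simp
  next
    case False
    \<comment> \<open>The numerator is the denominator without its factor for \<open>j\<close>,
      again a product of at most \<open>k\<close> linear factors.\<close>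
    let ?p = "\<Prod>j\<in>?J - {j}. g j"
    have "?J - {j} \<subseteq> {..k} - {j}" by auto
    then have "card (?J - {j}) \<le> card ({..k} - {j})" by (intro card_mono) auto
    then have "card (?J - {j}) \<le> k" using j by simp
    moreover have "degree ?p \<le> card (?J - {j})" by (rule deg) simp
    ultimately have dp: "degree ?p \<le> k" by simp
    have "(\<Prod>j\<in>?J. g j) = ?p * g j" using j False by (subst prod.remove[of _ j]) auto
    then have Qp: "Q = poly_mat ?p L * poly_mat (g j) L" by (simp add: Q_def poly_mat_mult[OF L])
    have GC: "poly_mat (g j) L \<in> carrier_mat n n" and PC: "poly_mat ?p L \<in> carrier_mat n n"
      using L by (simp_all add: poly_mat_carrier)
    note Gi = mat_inv[OF GC gL[OF j]]
    have s: "?s = mat_inv (poly_mat (g j) L) *\<^sub>v b"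
      using False L by (simp add: snapshot_vec_def g_def poly_mat_linear[OF L])
    have "poly_mat (g j) L *\<^sub>v ?s = b"
      unfolding s using GC Gi b by (simp flip: assoc_mult_mat_vec[of _ n n _ n])
    moreover have sC: "?s \<in> carrier_vec n" unfolding s using Gi(1) b by simp
    ultimately have "Q *\<^sub>v ?s = poly_mat ?p L *\<^sub>v b"
      unfolding Qp using PC GC by (simp add: assoc_mult_mat_vec[of _ n n _ n])
    then show ?thesis using dp sC by blast
  qed
  then obtain p where p: "degree p \<le> k" and s: "?s \<in> carrier_vec n"
    and Qs: "Q *\<^sub>v ?s = poly_mat p L *\<^sub>v b" by blast
  have "?s = mat_inv Q *\<^sub>v (Q *\<^sub>v ?s)"
    using Qi QC s by (simp flip: assoc_mult_mat_vec[of _ n n _ n])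
  then have "?s = mat_inv Q *\<^sub>v (poly_mat p L *\<^sub>v b)" by (simp only: Qs)
  then show ?thesis
    unfolding rational_krylov_space_def q
    using poly_mat_vec_in_krylov[OF L b p] L by (auto simp: Q_def)
qed

section \<open>Spectrum and holomorphy of the resolvent\<close>

text \<open>\<open>char_matrix\<close> carries the opposite sign to the matrix in the resolvent;
  negation does not affect whether the determinant vanishes.\<close>

lemma eigenvalue_iff_det:
  fixes A :: "'a::field mat"
  assumes A: "A \<in> carrier_mat n n"
  shows "eigenvalue A z \<longleftrightarrow> det (z \<cdot>\<^sub>m 1\<^sub>m n - A) = 0"
proof -
  have "- char_matrix A z = z \<cdot>\<^sub>m 1\<^sub>m n - A"
    using A by (intro eq_matI) (auto simp: char_matrix_def)
  then show ?thesis
    using eigenvalue_det[OF A, of z] det_0_negate[of "char_matrix A z" n] A by simp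
qed

lemma finite_eigenvalues:
  fixes A :: "'a::field mat"
  assumes A: "A \<in> carrier_mat n n"
  shows "finite {z. eigenvalue A z}"
proof -
  have "char_poly A \<noteq> 0" using degree_monic_char_poly[OF A] by auto
  then show ?thesis using poly_roots_finite by (simp add: eigenvalue_root_char_poly[OF A])
qed

text \<open>Cramer's rule turns the entries of an inverse into quotients of determinants, whose
  dependence on a parameter is easy to control.\<close>

lemma mat_inv_adj_mat:
  fixes A :: "'a::field mat"
  assumes A: "A \<in> carrier_mat n n" and d: "det A \<noteq> 0"
  shows "mat_inv A = inverse (det A) \<cdot>\<^sub>m adj_mat A"
proof (rule mat_inv_unique[OF A])
  show "inverse (det A) \<cdot>\<^sub>m adj_mat A \<in> carrier_mat n n" using adj_mat(1)[OF A] by simp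
  show "A * (inverse (det A) \<cdot>\<^sub>m adj_mat A) = 1\<^sub>m n"
    using adj_mat(2)[OF A] d by (simp add: mult_smult_distrib[OF A adj_mat(1)[OF A]]) (rule eq_matI, auto)
qed

text \<open>By the Leibniz formula the determinant is a finite sum of signed products of
  entries.\<close>

lemma holomorphic_on_det:
  assumes F: "\<And>z. F z \<in> carrier_mat n n"
    and h: "\<And>i j. i < n \<Longrightarrow> j < n \<Longrightarrow> (\<lambda>z. F z $$ (i, j)) holomorphic_on S"
  shows "(\<lambda>z. det (F z)) holomorphic_on S"
  unfolding det_def'[OF F]
  by (intro holomorphic_intros h) (use permutes_in_image in fastforce)+

text \<open>By Cramer's rule the entry is a signed minor divided by det(zI - A), and this
  denominator has no zero off the spectrum.\<close>

lemma holomorphic_on_resolvent: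
  assumes A: "A \<in> carrier_mat n n" and ij: "i < n" "j < n"
    and S: "\<And>z. z \<in> S \<Longrightarrow> \<not> eigenvalue A z"
  shows "(\<lambda>z. mat_inv (z \<cdot>\<^sub>m 1\<^sub>m n - A) $$ (i, j)) holomorphic_on S"
proof -
  let ?B = "\<lambda>z. z \<cdot>\<^sub>m 1\<^sub>m n - A"
  have B: "?B z \<in> carrier_mat n n" for z using A by (rule minus_carrier_mat)
  have d: "det (?B z) \<noteq> 0" if "z \<in> S" for z using S[OF that] eigenvalue_iff_det[OF A] by simp
  have ent: "(\<lambda>z. ?B z $$ (k, l)) holomorphic_on S" if "k < n" "l < n" for k l
    using that A by (auto intro!: holomorphic_intros)
  \<comment> \<open>The adjugate is the transposed cofactor matrix, hence row \<open>j\<close> and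
    column \<open>i\<close> are deleted for the entry \<open>(i, j)\<close>.\<close>
  have "(\<lambda>z. det (mat_delete (?B z) j i)) holomorphic_on S"
  proof (rule holomorphic_on_det)
    show "mat_delete (?B z) j i \<in> carrier_mat (n - 1) (n - 1)" for z
      using mat_delete_carrier[OF B] by simp
    fix k l assume kl: "k < n - 1" "l < n - 1"
    have "mat_delete (?B z) j i $$ (k, l)
        = ?B z $$ (if k < j then k else Suc k, if l < i then l else Suc l)" for z
      using kl A B[of z] unfolding mat_delete_def by simp
    then show "(\<lambda>z. mat_delete (?B z) j i $$ (k, l)) holomorphic_on S"
      using kl ent by (simp only:) auto
  qed
  then have "(\<lambda>z. inverse (det (?B z)) * ((-1) ^ (j + i) * det (mat_delete (?B z) j i))) holomorphic_on S"
    using d by (intro holomorphic_intros holomorphic_on_det[OF B] ent) auto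
  moreover have "mat_inv (?B z) $$ (i, j)
      = inverse (det (?B z)) * ((-1) ^ (j + i) * det (mat_delete (?B z) j i))" if "z \<in> S" for z
    using ij A by (simp add: mat_inv_adj_mat[OF B d[OF that]] adj_mat_def cofactor_def)
  ultimately show ?thesis by (simp cong: holomorphic_cong)
qed

section \<open>The functional calculus under similarity\<close>

text \<open>The linearity rules for \<open>residue\<close> are applied to functions holomorphic on a
  punctured neighbourhood; here one set \<open>S\<close> serves all summands.\<close>

lemma residue_sum_lmul:
  assumes "finite I" and S: "open S" "z0 \<in> S"
    and g: "\<And>i. i \<in> I \<Longrightarrow> g i holomorphic_on S - {z0}"
  shows "residue (\<lambda>z. \<Sum>i\<in>I. c i * g i z) z0 = (\<Sum>i\<in>I. c i * residue (g i) z0)"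
  using assms(1) g
proof (induction I)
  case empty
  show ?case by (simp add: residue_const)
next
  case (insert a I)
  have "(\<lambda>z. \<Sum>i\<in>I. c i * g i z) holomorphic_on S - {z0}" "(\<lambda>z. c a * g a z) holomorphic_on S - {z0}"
    using insert.prems by (auto intro!: holomorphic_intros)
  then show ?case
    using insert by (simp add: residue_add[OF S] residue_lmul[OF S])
qed

text \<open>The entry is a linear combination of the entries of \<open>R\<close> with coefficients
  that do not depend on \<open>R\<close>, so linear operations such as residues can be applied
  entrywise.\<close>

lemma triple_mult_index:
  fixes Q R P :: "'a::comm_semiring_0 mat"
  assumes "Q \<in> carrier_mat n n" "R \<in> carrier_mat n n" "P \<in> carrier_mat n n" "i < n" "j < n"
  shows "(Q * R * P) $$ (i, j) = (\<Sum>(k, l)\<in>{..<n} \<times> {..<n}. Q $$ (i, k) * P $$ (l, j) * R $$ (k, l))"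
proof -
  have "(Q * R * P) $$ (i, j) = (\<Sum>l<n. (\<Sum>k<n. Q $$ (i, k) * R $$ (k, l)) * P $$ (l, j))"
    using assms by (simp add: scalar_prod_def lessThan_atLeast0 del: assoc_mult_mat)
  also have "\<dots> = (\<Sum>k<n. \<Sum>l<n. Q $$ (i, k) * P $$ (l, j) * R $$ (k, l))"
    by (simp only: sum_distrib_right, subst sum.swap) (simp add: ac_simps)
  finally show ?thesis by (simp add: sum.cartesian_product)
qed

lemma mat_inv_similar:
  fixes A :: "'a::field mat"
  assumes A: "A \<in> carrier_mat n n" and P: "P \<in> carrier_mat n n" and Q: "Q \<in> carrier_mat n n"
    and QP: "Q * P = 1\<^sub>m n" and d: "det A \<noteq> 0"
  shows "mat_inv (Q * A * P) = Q * mat_inv A * P"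
proof (rule mat_inv_unique[of _ n])
  note i = mat_inv[OF A d]
  have PQ: "P * Q = 1\<^sub>m n" by (rule mat_mult_left_right_inverse[OF Q P QP])
  have "Q * A * P * (Q * mat_inv A * P) = Q * (A * ((P * Q) * (mat_inv A * P)))"
    using A P Q i(1) by (simp add: assoc_mult_mat[of _ n n _ n _ n])
  also have "\<dots> = Q * ((A * mat_inv A) * P)"
    using A P Q i(1) by (simp add: PQ assoc_mult_mat[of _ n n _ n _ n])
  also have "\<dots> = 1\<^sub>m n" using P QP by (simp add: i(2))
  finally show "Q * A * P * (Q * mat_inv A * P) = 1\<^sub>m n" .
qed (use assms mat_inv[OF A d] in auto)

text \<open>Similar matrices share their characteristic polynomial. Hence the sums over eigenvalues
  in \<open>mat_fun\<close> run over the same set.\<close>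

lemma eigenvalue_similar:
  fixes A :: "'a::field mat"
  assumes A: "A \<in> carrier_mat n n" and P: "P \<in> carrier_mat n n" and Q: "Q \<in> carrier_mat n n"
    and QP: "Q * P = 1\<^sub>m n"
  shows "eigenvalue (Q * A * P) z \<longleftrightarrow> eigenvalue A z"
proof -
  have "similar_mat (Q * A * P) A"
    using A P Q QP mat_mult_left_right_inverse[OF Q P QP]
    by (intro similar_matI[of _ _ Q P n]) auto
  moreover have "Q * A * P \<in> carrier_mat n n" using A P Q by simp
  ultimately show ?thesis
    using char_poly_similar eigenvalue_root_char_poly A by metis
qed

text \<open>The resolvent of Q A P is Q (zI - A)^(-1) P. Its entries are fixed linear combinations
  of those of the resolvent of A, and taking residues is linear once f is analytic at the
  eigenvalues.\<close>

lemma mat_fun_similar: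
  assumes A: "A \<in> carrier_mat n n" and P: "P \<in> carrier_mat n n" and Q: "Q \<in> carrier_mat n n"
    and QP: "Q * P = 1\<^sub>m n" and f: "\<And>z. eigenvalue A z \<Longrightarrow> f analytic_on {z}"
  shows "mat_fun f (Q * A * P) = Q * mat_fun f A * P"
proof (rule eq_matI)
  have F: "mat_fun f A \<in> carrier_mat n n" using A by (simp add: mat_fun_def)
  fix i j assume "i < dim_row (Q * mat_fun f A * P)" "j < dim_col (Q * mat_fun f A * P)"
  then have ij: "i < n" "j < n" using P Q by auto
  let ?B = "Q * A * P"
  let ?I = "{..<n} \<times> {..<n}"
  let ?g = "\<lambda>k l z. f z * mat_inv (z \<cdot>\<^sub>m 1\<^sub>m n - A) $$ (k, l)"
  have res: "residue (\<lambda>z. f z * mat_inv (z \<cdot>\<^sub>m 1\<^sub>m n - ?B) $$ (i, j)) \<mu>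
      = (\<Sum>(k, l)\<in>?I. Q $$ (i, k) * P $$ (l, j) * residue (?g k l) \<mu>)" if \<mu>: "eigenvalue A \<mu>" for \<mu>
  proof -
    obtain S0 where S0: "open S0" "\<mu> \<in> S0" "f holomorphic_on S0"
      using f[OF \<mu>] by (auto simp: analytic_on_holomorphic)
    \<comment> \<open>The other eigenvalues are finitely many, so removing them keeps the set open
      and isolates the singularity at \<open>\<mu>\<close>.\<close>
    define S where "S = S0 - ({z. eigenvalue A z} - {\<mu>})"
    have S: "open S" "\<mu> \<in> S" "f holomorphic_on S - {\<mu>}"
      using S0 finite_eigenvalues[OF A] unfolding S_def
      by (auto intro!: open_Diff finite_imp_closed intro: holomorphic_on_subset)
    have nev: "\<not> eigenvalue A z" if "z \<in> S - {\<mu>}" for z using that by (auto simp: S_def)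
    have eq: "f z * mat_inv (z \<cdot>\<^sub>m 1\<^sub>m n - ?B) $$ (i, j)
        = (\<Sum>p\<in>?I. (Q $$ (i, fst p) * P $$ (snd p, j)) * ?g (fst p) (snd p) z)" if z: "z \<in> S - {\<mu>}" for z
    proof -
      let ?A = "z \<cdot>\<^sub>m 1\<^sub>m n - A"
      have AC: "?A \<in> carrier_mat n n" using A by (rule minus_carrier_mat)
      have d: "det ?A \<noteq> 0" using nev[OF z] eigenvalue_iff_det[OF A] by simp
      have "Q * ?A * P = z \<cdot>\<^sub>m (Q * P) - ?B"
        using A P Q by (simp add: mult_minus_distrib_mat[of _ n n _ n] minus_mult_distrib_mat[of _ n n]
          mult_smult_distrib[of _ n n _ n] mult_smult_assoc_mat[of _ n n])
      then have "mat_inv (z \<cdot>\<^sub>m 1\<^sub>m n - ?B) = Q * mat_inv ?A * P"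
        using mat_inv_similar[OF AC P Q QP d] by (simp add: QP)
      then show ?thesis
        using triple_mult_index[OF Q mat_inv(1)[OF AC d] P ij]
        by (simp add: case_prod_beta sum_distrib_left ac_simps)
    qed
    \<comment> \<open>The pointwise identity is available only off \<open>\<mu>\<close>, where
      \<open>mat_inv\<close> is a genuine inverse. The residue depends only on such punctured
      values.\<close>
    have "residue (\<lambda>z. f z * mat_inv (z \<cdot>\<^sub>m 1\<^sub>m n - ?B) $$ (i, j)) \<mu>
      = residue (\<lambda>z. \<Sum>p\<in>?I. (Q $$ (i, fst p) * P $$ (snd p, j)) * ?g (fst p) (snd p) z) \<mu>"
      using eq S by (intro residue_cong refl) (auto simp: eventually_at_topological)
    also have "\<dots> = (\<Sum>p\<in>?I. (Q $$ (i, fst p) * P $$ (snd p, j)) * residue (?g (fst p) (snd p)) \<mu>)"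
      using S nev by (intro residue_sum_lmul[of _ S])
        (auto intro!: holomorphic_intros holomorphic_on_resolvent[OF A])
    finally show ?thesis by (simp add: case_prod_beta)
  qed
  have "mat_fun f ?B $$ (i, j) = (\<Sum>\<mu> | eigenvalue A \<mu>.
      residue (\<lambda>z. f z * mat_inv (z \<cdot>\<^sub>m 1\<^sub>m n - ?B) $$ (i, j)) \<mu>)"
    using ij Q by (simp add: mat_fun_def eigenvalue_similar[OF A P Q QP])
  also have "\<dots> = (\<Sum>\<mu> | eigenvalue A \<mu>.
      \<Sum>(k, l)\<in>?I. Q $$ (i, k) * P $$ (l, j) * residue (?g k l) \<mu>)"
    by (intro sum.cong refl) (auto simp: res)
  also have "\<dots> = (\<Sum>(k, l)\<in>?I. Q $$ (i, k) * P $$ (l, j) * mat_fun f A $$ (k, l))"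
    using A by (subst sum.swap) (auto simp: mat_fun_def sum_distrib_left intro!: sum.cong)
  also have "\<dots> = (Q * mat_fun f A * P) $$ (i, j)"
    by (rule triple_mult_index[OF Q F P ij, symmetric])
  finally show "mat_fun f ?B $$ (i, j) = (Q * mat_fun f A * P) $$ (i, j)" .
qed (use P Q in \<open>auto simp: mat_fun_def\<close>)

section \<open>Eigenvalues of compressions and the numerical range\<close>

lemma cscalar_prod_self:
  fixes y :: "complex vec"
  shows "y \<bullet>c y = of_real (\<Sum>i<dim_vec y. (cmod (y $ i))\<^sup>2)"
  by (simp add: scalar_prod_def complex_norm_square lessThan_atLeast0 del: of_real_power)

lemma cmat_gram:
  assumes W: "W \<in> carrier_mat n m" and WW: "transpose_mat W * W = 1\<^sub>m m"
  shows "cmat (transpose_mat W) * cmat W = 1\<^sub>m m"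
proof -
  have "cmat (transpose_mat W) * cmat W = cmat (transpose_mat W * W)"
    using W by (intro of_real_hom.mat_hom_mult[symmetric]) auto
  then show ?thesis by (simp add: WW of_real_hom.mat_hom_one)
qed

lemma conjugate_cmat_mult_vec:
  assumes "W \<in> carrier_mat n m" "v \<in> carrier_vec m"
  shows "conjugate (cmat W *\<^sub>v v) = cmat W *\<^sub>v conjugate v"
  using assms by (intro eq_vecI) (auto simp: scalar_prod_def)

text \<open>For an eigenvector v of the compression put y = Wv. Then y^* L y = v^* (W^T L W) v =
  \<mu> v^* v, and y^* y = v^* v because W has orthonormal columns. Normalizing y gives the required
  unit vector.\<close>

lemma eigenvalue_compression_in_numerical_range:
  assumes L: "L \<in> carrier_mat n n" and W: "W \<in> carrier_mat n m"
    and WW: "transpose_mat W * W = 1\<^sub>m m"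
    and ev: "eigenvalue (cmat (transpose_mat W * L * W)) \<mu>"
  shows "\<mu> \<in> numerical_range (cmat L)"
proof -
  let ?L = "cmat L" and ?W = "cmat W" and ?T = "cmat (transpose_mat W)"
  have TC: "?T \<in> carrier_mat m n" and LC: "?L \<in> carrier_mat n n" and WC: "?W \<in> carrier_mat n m"
    using L W by auto
  have A: "cmat (transpose_mat W * L * W) = ?T * ?L * ?W"
    using L W by (simp add: of_real_hom.mat_hom_mult[of _ m n _ m] of_real_hom.mat_hom_mult[of _ n n _ m])
  have TW: "?T * ?W = 1\<^sub>m m"
    by (rule cmat_gram[OF W WW])
  obtain v where v: "v \<in> carrier_vec m" "v \<noteq> 0\<^sub>v m" "?T * ?L * ?W *\<^sub>v v = \<mu> \<cdot>\<^sub>v v"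
    using ev L W unfolding eigenvalue_def eigenvector_def A by auto
  define y where "y = ?W *\<^sub>v v"
  have yC: "y \<in> carrier_vec n" using v(1) WC by (simp add: y_def)
  have tW: "transpose_mat ?W = ?T" by (rule eq_matI) auto
  \<comment> \<open>Since \<open>W\<close> is real, its complex adjoint is the plain
    transpose.\<close>
  have adj: "u \<bullet>c y = (?T *\<^sub>v u) \<bullet>c v" if u: "u \<in> carrier_vec n" for u
    using transpose_vec_mult_scalar[OF WC carrier_vec_conjugate[OF v(1)] u] W v(1)
    by (simp add: y_def conjugate_cmat_mult_vec[OF W v(1)] tW)
  have Ty: "?T *\<^sub>v y = v"
    using v(1) TC WC by (simp add: y_def TW flip: assoc_mult_mat_vec[of _ m n _ m])
  have yy: "y \<bullet>c y = v \<bullet>c v" using adj[OF yC] by (simp add: Ty)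
  have LyC: "?L *\<^sub>v y \<in> carrier_vec n" using LC yC by simp
  have TLy: "?T *\<^sub>v (?L *\<^sub>v y) = \<mu> \<cdot>\<^sub>v v"
    using v TC LC WC by (simp add: y_def assoc_mult_mat_vec[of _ m n _ m] assoc_mult_mat_vec[of _ m n _ n])
  have Ly: "(?L *\<^sub>v y) \<bullet>c y = \<mu> * (y \<bullet>c y)"
    using adj[OF LyC] v(1) by (simp add: TLy yy)
  \<comment> \<open>This is the Euclidean norm of \<open>y\<close>; it is nonzero because
    \<open>y\<close> and the eigenvector \<open>v\<close> have the same norm.\<close>
  define s where "s = sqrt (\<Sum>i<n. (cmod (y $ i))\<^sup>2)"
  have s2: "s\<^sup>2 = (\<Sum>i<n. (cmod (y $ i))\<^sup>2)" by (simp add: s_def sum_nonneg)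
  have yys: "y \<bullet>c y = (of_real s)\<^sup>2"
    using yC by (simp add: cscalar_prod_self flip: s2 of_real_power)
  have "y \<bullet>c y \<noteq> 0" unfolding yy using v(1,2) by simp
  then have s0: "s \<noteq> 0" by (auto simp: yys)
  have spos: "s > 0" using s0 by (simp add: s_def sum_nonneg order_less_le)
  define x where "x = of_real (1 / s) \<cdot>\<^sub>v y"
  have xC: "x \<in> carrier_vec n" using yC by (simp add: x_def)
  have cx: "conjugate x = of_real (1 / s) \<cdot>\<^sub>v conjugate y" by (simp add: x_def conjugate_smult_vec)
  have "(?L *\<^sub>v x) \<bullet>c x = of_real (1 / s) * (of_real (1 / s) * ((?L *\<^sub>v y) \<bullet>c y))"
    unfolding cx using yC LC by (simp add: x_def mult_mat_vec[of _ n n])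
  also have "\<dots> = \<mu>" using s0 by (simp add: Ly yys power2_eq_square)
  finally have 1: "(?L *\<^sub>v x) \<bullet>c x = \<mu>" .
  have "(\<Sum>i<n. (cmod (x $ i))\<^sup>2) = (\<Sum>i<n. (cmod (y $ i))\<^sup>2 / s\<^sup>2)"
    using yC spos by (intro sum.cong refl) (simp add: x_def norm_divide power_divide)
  also have "\<dots> = 1" using s0 by (simp flip: sum_divide_distrib s2)
  finally have 2: "sqrt (\<Sum>i<n. (cmod (x $ i))\<^sup>2) = 1" by simp
  show ?thesis unfolding numerical_range_def using 1 2 xC L by force
qed

section \<open>Orthonormal bases and orthogonal coordinate changes\<close>

lemma orthonormal_basis_mat_gram:
  assumes "orthonormal_basis_mat n m V S"
  shows "transpose_mat V * V = 1\<^sub>m m"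
  using assms by (intro eq_matI) (auto simp: orthonormal_basis_mat_def)

text \<open>The fixed vectors of a linear map form a submodule, which contains the span as soon as
  it contains the generators.\<close>

lemma fixed_on_span:
  assumes P: "P \<in> carrier_mat n n" and S: "\<And>x. x \<in> S \<Longrightarrow> x \<in> carrier_vec n \<and> P *\<^sub>v x = x"
    and x: "x \<in> vec_span n S"
  shows "P *\<^sub>v x = x"
proof -
  interpret vec_space "TYPE(real)" n .
  let ?N = "{x \<in> carrier_vec n. P *\<^sub>v x = x}"
  have "submodule class_ring ?N (module_vec TYPE(real) n)"
    unfolding submodule_def using P module_axioms
    by (auto simp: mult_add_distrib_mat_vec[of _ n n] mult_mat_vec[of _ n n])
  then have "span S \<subseteq> ?N" using S by (intro span_is_subset) auto
  then show ?thesis using x by auto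
qed

text \<open>W W^T is the orthogonal projection onto the column space: (W W^T) W = W (W^T W) = W
  shows that it fixes every column.\<close>

lemma projection_fixes_span:
  assumes W: "orthonormal_basis_mat n m W S" and x: "x \<in> S"
  shows "W * transpose_mat W *\<^sub>v x = x"
proof (rule fixed_on_span)
  have WC: "W \<in> carrier_mat n m" using W by (simp add: orthonormal_basis_mat_def)
  show PC: "W * transpose_mat W \<in> carrier_mat n n" using WC by simp
  show "x \<in> vec_span n (set (cols W))" using W x by (simp add: orthonormal_basis_mat_def)
  have "W * transpose_mat W * W = W * (transpose_mat W * W)"
    using WC by (intro assoc_mult_mat[of _ n m _ n _ m]) auto
  then have PW: "W * transpose_mat W * W = W"
    using WC by (simp add: orthonormal_basis_mat_gram[OF W])
  fix u assume "u \<in> set (cols W)"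
  then obtain j where j: "j < m" "u = col W j" using WC by (auto simp: cols_def)
  then show "u \<in> carrier_vec n \<and> W * transpose_mat W *\<^sub>v u = u"
    using WC col_mult2[OF PC WC j(1)] PW by auto
qed

text \<open>The columns of V lie in T, so W W^T fixes them and V = W U. Then U^T U = V^T W U = V^T V
  = I. Both bases have \<open>m\<close> elements, which makes U square.\<close>

lemma orthogonal_change_of_basis:
  assumes V: "orthonormal_basis_mat n m V S" and W: "orthonormal_basis_mat n m W T" and ST: "S \<subseteq> T"
  defines "U \<equiv> transpose_mat W * V"
  shows "U \<in> carrier_mat m m" and "V = W * U" and "transpose_mat U * U = 1\<^sub>m m"
proof -
  interpret vec_space "TYPE(real)" n .
  have VC: "V \<in> carrier_mat n m" and WC: "W \<in> carrier_mat n m"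
    using V W by (simp_all add: orthonormal_basis_mat_def)
  show UC: "U \<in> carrier_mat m m" using VC WC by (simp add: U_def)
  have "set (cols V) \<subseteq> T"
    using in_own_span[of "set (cols V)"] cols_dim[of V] VC V ST by (auto simp: orthonormal_basis_mat_def)
  then have "W * transpose_mat W *\<^sub>v col V j = col V j" if "j < m" for j
    using that VC by (intro projection_fixes_span[OF W]) (auto simp: cols_def)
  then have "W * transpose_mat W * V = V"
    using VC WC by (intro mat_col_eqI) (auto simp: col_mult2[of _ n n _ m] simp del: assoc_mult_mat assoc_mult_mat_vec)
  then show VU: "V = W * U"
    using VC WC by (simp add: U_def assoc_mult_mat[of _ n m _ n _ m])
  have "transpose_mat U * U = transpose_mat V * (W * U)"
    using VC WC UC unfolding U_def
    by (simp add: transpose_mult[of _ m n _ m] assoc_mult_mat[of _ m n _ m _ m])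
  then show "transpose_mat U * U = 1\<^sub>m m"
    by (simp add: orthonormal_basis_mat_gram[OF V] flip: VU)
qed

section \<open>Invariance of the projected approximation\<close>

text \<open>The compression to W U is U^T (W^T L W) U, so f of it is U^T f(W^T L W) U. The outer
  factors U and U^T then cancel against those from the basis and from the projected vector.\<close>

lemma projected_approx_change_of_basis:
  assumes L: "L \<in> carrier_mat n n" and b: "b \<in> carrier_vec n" and W: "W \<in> carrier_mat n m"
    and WW: "transpose_mat W * W = 1\<^sub>m m"
    and U: "U \<in> carrier_mat m m" and UU: "transpose_mat U * U = 1\<^sub>m m"
    and f: "f analytic_on numerical_range (cmat L)"
  shows "projected_approx f L b (W * U) = projected_approx f L b W"
proof -
  let ?U = "cmat U" and ?T = "cmat (transpose_mat U)" and ?W = "cmat W"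
  let ?A = "cmat (transpose_mat W * L * W)"
  let ?c = "cvec (transpose_mat W *\<^sub>v b)"
  have UC: "?U \<in> carrier_mat m m" and TC: "?T \<in> carrier_mat m m" and WC: "?W \<in> carrier_mat n m"
    and AC: "?A \<in> carrier_mat m m" and cC: "?c \<in> carrier_vec m"
    using U W L b by auto
  have TU: "?T * ?U = 1\<^sub>m m"
    by (rule cmat_gram[OF U UU])
  \<comment> \<open>For square matrices a left inverse is also a right inverse; the cancellations
    below need this order of the factors.\<close>
  have UT: "?U * ?T = 1\<^sub>m m" by (rule mat_mult_left_right_inverse[OF TC UC TU])
  have "transpose_mat (W * U) * L * (W * U) = transpose_mat U * (transpose_mat W * L * W) * U"
    using U W L by (simp add: transpose_mult[of _ n m _ m] assoc_mult_mat[of _ m m _ n _ m]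
      assoc_mult_mat[of _ m n _ m _ m] assoc_mult_mat[of _ m m _ n _ n] assoc_mult_mat[of _ m n _ n _ m]
      assoc_mult_mat[of _ m m _ m _ m] assoc_mult_mat[of _ n m _ m _ m] assoc_mult_mat[of _ n n _ m _ m])
  then have "cmat (transpose_mat (W * U) * L * (W * U)) = ?T * ?A * ?U"
    using U W L by (simp add: of_real_hom.mat_hom_mult[of _ m m _ m])
  moreover have "mat_fun f (?T * ?A * ?U) = ?T * mat_fun f ?A * ?U"
    by (intro mat_fun_similar[OF AC UC TC TU])
      (auto intro: analytic_on_subset[OF f] eigenvalue_compression_in_numerical_range[OF L W WW])
  moreover have "cvec (transpose_mat (W * U) *\<^sub>v b) = ?T *\<^sub>v ?c"
    using U W b by (simp add: transpose_mult[of _ n m _ m] assoc_mult_mat_vec[of _ m m _ n]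
      of_real_hom.mult_mat_vec_hom[of _ m m])
  moreover have "cmat (W * U) = ?W * ?U"
    using U W by (simp add: of_real_hom.mat_hom_mult[of _ n m _ m])
  ultimately have "projected_approx f L b (W * U)
      = ?W * ?U *\<^sub>v (?T * mat_fun f ?A * ?U *\<^sub>v (?T *\<^sub>v ?c))"
    by (simp add: projected_approx_def)
  also have "\<dots> = ?W *\<^sub>v (mat_fun f ?A *\<^sub>v ?c)"
  proof -
    have FC: "mat_fun f ?A \<in> carrier_mat m m" using W by (simp add: mat_fun_def)
    have c: "?U *\<^sub>v (?T *\<^sub>v x) = x" if "x \<in> carrier_vec m" for x
      using that UC TC UT by (simp flip: assoc_mult_mat_vec[of _ m m _ m])
    have "?T * mat_fun f ?A * ?U *\<^sub>v (?T *\<^sub>v ?c) = ?T *\<^sub>v (mat_fun f ?A *\<^sub>v ?c)"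
      using FC UC TC cC by (simp add: assoc_mult_mat_vec[of _ m m _ m] c)
    moreover have "mat_fun f ?A *\<^sub>v ?c \<in> carrier_vec m" using FC cC by simp
    ultimately show ?thesis
      using FC UC TC WC cC c by (simp add: assoc_mult_mat_vec[of _ n m _ m])
  qed
  finally show ?thesis by (simp add: projected_approx_def)
qed

theorem theorem4:
  fixes n k :: nat
    and M K L V W :: "real mat"
    and b :: "real Matrix.vec"
    and f :: "complex \<Rightarrow> complex"
    and t :: "nat \<Rightarrow> ereal"
  assumes "spd_mat n M" and "spd_mat n K"
    and "L = mat_inv M * K"
    and "b \<in> carrier_vec n"
    and "f analytic_on numerical_range (cmat L)"
    and "\<And>j. j \<le> k \<Longrightarrow> 0 \<le> t j"
    and "inj_on t {..k}"
    and "orthonormal_basis_mat n (k + 1) V (reduced_space L b k t)"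
    and "orthonormal_basis_mat n (k + 1) W (rational_krylov_space L b k (\<lambda>j. - t j))"
  shows "projected_approx f L b V = projected_approx f L b W"
proof -
  interpret vec_space "TYPE(real)" n .
  have MC: "M \<in> carrier_mat n n" and KC: "K \<in> carrier_mat n n"
    using assms(1,2) by (simp_all add: spd_mat_def)
  have L: "L \<in> carrier_mat n n"
    using mat_inv(1)[OF MC spd_det_nonzero[OF assms(1)]] KC by (simp add: assms(3))
  have inv: "det (s \<cdot>\<^sub>m 1\<^sub>m n + L) \<noteq> 0" if "0 \<le> s" for s
    unfolding assms(3) by (rule det_shifted_nonzero[OF assms(1,2) that])
  let ?R = "rational_krylov_space L b k (\<lambda>j. - t j)"
  have WC: "W \<in> carrier_mat n (k + 1)" and R: "span (set (cols W)) = ?R"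
    using assms(9) by (simp_all add: orthonormal_basis_mat_def)
  have "(\<lambda>j. snapshot_vec L b (t j)) ` {..k} \<subseteq> ?R"
    using snapshot_in_rational_krylov_space[OF L assms(4) inv assms(6)] by auto
  \<comment> \<open>Closure under linear combinations is read off from \<open>?R\<close> being the
    column span of \<open>W\<close>. Containing the snapshots then implies containing their
    span.\<close>
  moreover have "submodule class_ring ?R (module_vec TYPE(real) n)"
    unfolding R[symmetric] using cols_dim[of W] WC by (intro span_is_submodule) auto
  ultimately have sub: "reduced_space L b k t \<subseteq> ?R"
    unfolding reduced_space_def using L by (auto dest: span_is_subset)
  \<comment> \<open>One inclusion is enough here, because both bases have k + 1 columns.\<close>
  note U = orthogonal_change_of_basis[OF assms(8,9) sub]
  show ?thesis
    using projected_approx_change_of_basis[OF L assms(4) WC orthonormal_basis_mat_gram[OF assms(9)] U(1,3) assms(5)]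
    by (simp flip: U(2))
qed

end
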